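(* Let $T$ be a (possibly unbounded) self-adjoint operator on a Hilbert space $\mathcal{H}$, with bounded transform $S=T(I+T^2)^{-1/2}$, and let $A\subset B(\mathcal{H})$ be a von Neumann algebra. Then $T$ is affiliated to $A$ if and only if $S\in A$.
   Context: $\mathcal{H}$ is a complex Hilbert space and $T$ is a densely defined operator with $T^*=T$, not assumed bounded. Its bounded transform $S=T\sqrt{I+T^2}^{\,-1}$ is a bounded self-adjoint operator with $\|Sx\|<\|x\|$ for all $x\neq0$, and $T=S\sqrt{I-S^2}^{\,-1}$. A von Neumann algebra $A\subset B(\mathcal{H})$ is a unital $*$-subalgebra with $A''=A$, where $A'$ denotes the commutant in $B(\mathcal{H})$. A bounded operator $R\in B(\mathcal{H})$ is said to commute with a closed (possibly unbounded) operator $X$ if for every $\psi\in\mathcal{D}(X)$ one has $R\psi\in\mathcal{D}(X)$ and $RX\psi=XR\psi$. A closed operator $X$ is affiliated to $A$ (written $X\,\eta\,A$) if every $R\in A'$ commutes with $X$ in this sense. *)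

theory Defs
  imports "HOL-Analysis.Analysis"
begin

section \<open>Complex Hilbert spaces\<close>

text \<open>
  Every complex Hilbert space is a real Hilbert space under the real part of its inner product, so
  the class extends the library's complete real inner product spaces; this fixes norm and topology.
  The inner product is antilinear in the first and linear in the second argument.
\<close>

class complex_hilbert_space = real_inner + complete_space +
  fixes scaleC :: "complex \<Rightarrow> 'a \<Rightarrow> 'a"  (infixr \<open>*\<^sub>C\<close> 75)
    and cinner :: "'a \<Rightarrow> 'a \<Rightarrow> complex"
  assumes scaleC_add_right: "c *\<^sub>C (x + y) = c *\<^sub>C x + c *\<^sub>C y"
    and scaleC_add_left: "(c + d) *\<^sub>C x = c *\<^sub>C x + d *\<^sub>C x"
    and scaleC_scaleC: "c *\<^sub>C d *\<^sub>C x = (c * d) *\<^sub>C x"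
    and scaleC_of_real: "complex_of_real r *\<^sub>C x = r *\<^sub>R x"
    and cinner_commute: "cinner x y = cnj (cinner y x)"
    and cinner_add_right: "cinner x (y + z) = cinner x y + cinner x z"
    and cinner_scaleC_right: "cinner x (c *\<^sub>C y) = c * cinner x y"
    and Re_cinner: "Re (cinner x y) = inner x y"

lemma cinner_self: "cinner x x = complex_of_real ((norm x)\<^sup>2)"
proof (rule complex_eqI)
  show "Re (cinner x x) = Re (complex_of_real ((norm x)\<^sup>2))"
    by (simp add: Re_cinner power2_norm_eq_inner)
  have "Im (cinner x x) = - Im (cinner x x)"
    by (metis cinner_commute cnj.simps(2))
  then show "Im (cinner x x) = Im (complex_of_real ((norm x)\<^sup>2))"
    by simp
qed

instantiation complex :: complex_hilbert_space
begin

definition scaleC_complex :: "complex \<Rightarrow> complex \<Rightarrow> complex" where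
  "scaleC_complex = (*)"

definition cinner_complex :: "complex \<Rightarrow> complex \<Rightarrow> complex" where
  "cinner_complex x y = cnj x * y"

instance
  by standard
    (auto simp: scaleC_complex_def cinner_complex_def algebra_simps scaleR_conv_of_real
      inner_complex_def)

end


section \<open>Possibly unbounded operators\<close>

text \<open>
  An operator with domain \<^term>\<open>dom T\<close> is a partial function, so that equality of operators
  includes equality of domains, and products carry their natural domain under
  \<^term>\<open>(\<circ>\<^sub>m)\<close>. Bounded operators are total functions, which \<open>total_op\<close> regards
  as partial ones with full domain.
\<close>

type_synonym 'a operator = "'a \<rightharpoonup> 'a"

definition total_op :: "('a \<Rightarrow> 'a) \<Rightarrow> 'a operator" where
  "total_op R = (\<lambda>x. Some (R x))"

definition linear_op :: "'a::complex_hilbert_space operator \<Rightarrow> bool" where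
  "linear_op T \<longleftrightarrow> T 0 = Some 0
     \<and> (\<forall>x y u v. T x = Some u \<longrightarrow> T y = Some v \<longrightarrow> T (x + y) = Some (u + v))
     \<and> (\<forall>c x u. T x = Some u \<longrightarrow> T (c *\<^sub>C x) = Some (c *\<^sub>C u))"

definition densely_defined :: "'a::complex_hilbert_space operator \<Rightarrow> bool" where
  "densely_defined T \<longleftrightarrow> linear_op T \<and> closure (dom T) = UNIV"

definition closed_op :: "'a::complex_hilbert_space operator \<Rightarrow> bool" where
  "closed_op T \<longleftrightarrow> linear_op T \<and> closed (Map.graph T)"

definition op_add :: "'a::complex_hilbert_space operator \<Rightarrow> 'a operator \<Rightarrow> 'a operator" where
  "op_add T U = (\<lambda>x. case (T x, U x) of (Some u, Some v) \<Rightarrow> Some (u + v) | _ \<Rightarrow> None)"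

text \<open>Intended for injective operators; the domain of the inverse is the range of the operator.\<close>

definition op_inverse :: "'a operator \<Rightarrow> 'a operator" where
  "op_inverse T = (\<lambda>y. if y \<in> ran T then Some (THE x. T x = Some y) else None)"

text \<open>Intended for densely defined operators, for which the vector \<open>z\<close> is unique.\<close>

definition op_adjoint :: "'a::complex_hilbert_space operator \<Rightarrow> 'a operator" where
  "op_adjoint T = (\<lambda>x.
     if \<exists>z. \<forall>y v. T y = Some v \<longrightarrow> cinner x v = cinner z y
     then Some (THE z. \<forall>y v. T y = Some v \<longrightarrow> cinner x v = cinner z y)
     else None)"

definition selfadjoint_op :: "'a::complex_hilbert_space operator \<Rightarrow> bool" where
  "selfadjoint_op T \<longleftrightarrow> densely_defined T \<and> op_adjoint T = T"

definition positive_op :: "'a::complex_hilbert_space operator \<Rightarrow> bool" where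
  "positive_op T \<longleftrightarrow> (\<forall>x u. T x = Some u \<longrightarrow> cinner x u \<in> \<real>\<^sub>\<ge>\<^sub>0)"

text \<open>
  The unique positive self-adjoint square root of a positive self-adjoint operator, which may itself
  be unbounded.
\<close>

definition op_sqrt :: "'a::complex_hilbert_space operator \<Rightarrow> 'a operator" where
  "op_sqrt P = (THE R. selfadjoint_op R \<and> positive_op R \<and> R \<circ>\<^sub>m R = P)"

definition bounded_transform :: "'a::complex_hilbert_space operator \<Rightarrow> 'a operator" where
  "bounded_transform T = T \<circ>\<^sub>m op_inverse (op_sqrt (op_add (total_op id) (T \<circ>\<^sub>m T)))"


section \<open>Von Neumann algebras and affiliation\<close>

definition bounded_ops :: "('a::complex_hilbert_space \<Rightarrow> 'a) set" where
  "bounded_ops = {R. bounded_linear R \<and> (\<forall>c x. R (c *\<^sub>C x) = c *\<^sub>C R x)}"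

definition commutant ::
  "('a::complex_hilbert_space \<Rightarrow> 'a) set \<Rightarrow> ('a \<Rightarrow> 'a) set" where
  "commutant M = {R \<in> bounded_ops. \<forall>X\<in>M. R \<circ> X = X \<circ> R}"

definition von_neumann_algebra :: "('a::complex_hilbert_space \<Rightarrow> 'a) set \<Rightarrow> bool" where
  "von_neumann_algebra A \<longleftrightarrow> A \<subseteq> bounded_ops \<and> id \<in> A
     \<and> (\<forall>R\<in>A. \<forall>Q\<in>A. (\<lambda>x. R x + Q x) \<in> A)
     \<and> (\<forall>c. \<forall>R\<in>A. (\<lambda>x. c *\<^sub>C R x) \<in> A)
     \<and> (\<forall>R\<in>A. \<forall>Q\<in>A. R \<circ> Q \<in> A)
     \<and> (\<forall>R\<in>A. op_adjoint (total_op R) \<in> total_op ` A)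
     \<and> commutant (commutant A) = A"

definition commutes_with ::
  "('a::complex_hilbert_space \<Rightarrow> 'a) \<Rightarrow> 'a operator \<Rightarrow> bool" where
  "commutes_with R X \<longleftrightarrow>
     (\<forall>\<psi>\<in>dom X. R \<psi> \<in> dom X \<and> R (the (X \<psi>)) = the (X (R \<psi>)))"

definition affiliated ::
  "'a::complex_hilbert_space operator \<Rightarrow> ('a \<Rightarrow> 'a) set \<Rightarrow> bool" where
  "affiliated X A \<longleftrightarrow> closed_op X \<and> (\<forall>R\<in>commutant A. commutes_with R X)"

end

theory Submission
  imports Defs
begin

text \<open>
  Projecting \<open>(x, 0)\<close> onto the closed graph of \<open>T\<close> solves \<open>y + T\<^sup>2 y = x\<close>, so that
  \<open>B = (I + T\<^sup>2)\<^sup>-\<^sup>1\<close> is an everywhere defined bounded operator. Since \<open>I - B\<close> is a contraction,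
  the recursion \<open>Y \<mapsto> (I - B + Y\<^sup>2) / 2\<close>, dominated by the corresponding scalar recursion, converges
  in norm, and \<open>C = I - Y\<close> is the positive square root of \<open>B\<close>; it commutes with all that commutes with
  \<open>B\<close>. Then \<open>C\<^sup>-\<^sup>1\<close> is the square root of \<open>I + T\<^sup>2\<close>, and \<open>S = T C\<close> is bounded.

  If \<open>R\<close> commutes with \<open>T\<close>, it commutes with \<open>B\<close>, hence with \<open>C\<close> and with \<open>S\<close>. Thus affiliation
  puts \<open>S\<close> in the bicommutant of the algebra. Conversely, if \<open>S\<close> lies in the algebra, so does
  \<open>S\<^sup>*\<close>; then \<open>R\<close> in the commutant commutes with \<open>S\<^sup>* S = I - B\<close>, hence with \<open>C\<close>, and
  therefore with \<open>T\<close>, because every \<open>x\<close> in its domain is \<open>C (C x + S\<^sup>* T x)\<close>.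
\<close>

instance complex_hilbert_space \<subseteq> banach ..

section \<open>Real Hilbert spaces\<close>

lemma nearest_point_exists:
  fixes V :: "'a::{real_inner,banach} set"
  assumes "subspace V" "closed V"
  shows "\<exists>v\<in>V. \<forall>w\<in>V. norm (x - v) \<le> norm (x - w)"
proof -
  define d where "d = infdist x V"
  have ne: "V \<noteq> {}" using subspace_0[OF assms(1)] by auto
  have d_le: "d \<le> norm (x - w)" if "w \<in> V" for w
    using infdist_le[OF that, of x] by (simp add: d_def dist_norm)
  have d0: "0 \<le> d" by (simp add: d_def infdist_nonneg)
  have "\<exists>v\<in>V. (norm (x - v))\<^sup>2 < d\<^sup>2 + 1 / real (Suc n)" for n
  proof -
    have "d < sqrt (d\<^sup>2 + 1 / real (Suc n))"
      using d0 by (intro real_less_rsqrt) simp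
    then obtain v where v: "v \<in> V" "dist x v < sqrt (d\<^sup>2 + 1 / real (Suc n))"
      unfolding d_def infdist_notempty[OF ne] using cInf_lessD[of "dist x ` V"] ne by fastforce
    have "(norm (x - v))\<^sup>2 < (sqrt (d\<^sup>2 + 1 / real (Suc n)))\<^sup>2"
      using v(2) by (intro power_strict_mono) (auto simp: dist_norm)
    then show ?thesis using v(1) by (auto simp: add_nonneg_nonneg)
  qed
  then obtain v where vV: "\<And>n. v n \<in> V"
    and v: "\<And>n. (norm (x - v n))\<^sup>2 < d\<^sup>2 + 1 / real (Suc n)"
    by metis
  \<comment> \<open>By the parallelogram law at the midpoint of \<open>v m\<close> and
    \<open>v n\<close>: it lies in \<open>V\<close>, so its distance from \<open>x\<close> is at
    least \<open>d\<close>. This makes the minimising sequence Cauchy.\<close>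
  have gap: "(norm (v m - v n))\<^sup>2 \<le> 2 / real (Suc m) + 2 / real (Suc n)" for m n
  proof -
    have "(1/2) *\<^sub>R (v m + v n) \<in> V"
      by (intro subspace_scale subspace_add assms vV)
    then have "d\<^sup>2 \<le> (norm (x - (1/2) *\<^sub>R (v m + v n)))\<^sup>2"
      using d_le d0 by (intro power_mono) auto
    moreover have "(norm (v m - v n))\<^sup>2 = 2 * (norm (x - v m))\<^sup>2 + 2 * (norm (x - v n))\<^sup>2
        - 4 * (norm (x - (1/2) *\<^sub>R (v m + v n)))\<^sup>2"
      unfolding power2_norm_eq_inner
      by (simp add: algebra_simps inner_commute)
    ultimately show ?thesis using v[of m] v[of n] by simp
  qed
  have "Cauchy v"
  proof (rule metric_CauchyI)
    fix e :: real assume e: "0 < e"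
    obtain M where M: "4 / e\<^sup>2 < real M" using reals_Archimedean2 by blast
    have "dist (v m) (v n) < e" if "M \<le> m" "M \<le> n" for m n
    proof -
      have Mpos: "0 < real M" using M e by (smt (verit) divide_pos_pos zero_less_power)
      have "2 / real (Suc k) < 2 / real M" if "M \<le> k" for k
        using that Mpos by (intro divide_strict_left_mono) auto
      then have "2 / real (Suc m) + 2 / real (Suc n) < 4 / real M"
        using \<open>M \<le> m\<close> \<open>M \<le> n\<close> by (smt (verit) add_divide_distrib)
      moreover have "4 / real M < e\<^sup>2"
        using M Mpos e by (simp add: field_simps)
      ultimately have "(norm (v m - v n))\<^sup>2 < e\<^sup>2" using gap[of m n] by simp
      then show ?thesis
        using e power2_less_imp_less[of "norm (v m - v n)" e] by (simp add: dist_norm)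
    qed
    then show "\<exists>M. \<forall>m\<ge>M. \<forall>n\<ge>M. dist (v m) (v n) < e" by blast
  qed
  then obtain u where u: "v \<longlonglongrightarrow> u" using Cauchy_convergent convergent_def by blast
  have uV: "u \<in> V" using closed_sequentially[OF assms(2)] vV u by blast
  have "(\<lambda>n. (norm (x - v n))\<^sup>2) \<longlonglongrightarrow> (norm (x - u))\<^sup>2"
    by (intro tendsto_intros u)
  moreover have "(\<lambda>n. d\<^sup>2 + 1 / real (Suc n)) \<longlonglongrightarrow> d\<^sup>2 + 0"
    by (intro tendsto_intros LIMSEQ_Suc lim_1_over_n)
  ultimately have "(norm (x - u))\<^sup>2 \<le> d\<^sup>2 + 0"
    using v by (intro LIMSEQ_le) (auto intro!: exI[of _ 0] less_imp_le)
  then have "norm (x - u) \<le> d" using d0 by (intro power2_le_imp_le[OF _ d0]) simp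
  then show ?thesis using uV d_le by (metis order_trans)
qed

lemma orthogonal_projection_exists:
  fixes V :: "'a::{real_inner,banach} set"
  assumes "subspace V" "closed V"
  shows "\<exists>v\<in>V. \<forall>w\<in>V. inner (x - v) w = 0"
proof -
  obtain v where vV: "v \<in> V" and min: "\<And>w. w \<in> V \<Longrightarrow> norm (x - v) \<le> norm (x - w)"
    using nearest_point_exists[OF assms] by metis
  have "inner (x - v) w = 0" if w: "w \<in> V" for w
  proof (cases "w = 0")
    case False
    \<comment> \<open>This \<open>t\<close> minimises the quadratic
      \<open>norm (x - v - t *\<^sub>R w)\<close> squared; minimality of \<open>v\<close> then
      leaves no room for a nonzero inner product.\<close>
    define t where "t = inner (x - v) w / inner w w"
    have "v + t *\<^sub>R w \<in> V" by (intro subspace_add subspace_scale assms vV w)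
    then have "(norm (x - v))\<^sup>2 \<le> (norm (x - (v + t *\<^sub>R w)))\<^sup>2"
      using min by (intro power_mono) auto
    also have "\<dots> = (norm ((x - v) - t *\<^sub>R w))\<^sup>2" by (simp add: algebra_simps)
    also have "\<dots> = (norm (x - v))\<^sup>2 - 2 * t * inner (x - v) w + t\<^sup>2 * inner w w"
      unfolding power2_norm_eq_inner
      by (simp add: inner_diff_left inner_diff_right inner_commute power2_eq_square algebra_simps)
    also have "t\<^sup>2 * inner w w = t * inner (x - v) w"
      using False by (simp add: t_def power2_eq_square)
    finally have "t * inner (x - v) w \<le> 0" by simp
    then have "(inner (x - v) w)\<^sup>2 / inner w w \<le> 0" by (simp add: t_def power2_eq_square)
    moreover have "0 < inner w w" using False by simp
    ultimately have "(inner (x - v) w)\<^sup>2 \<le> 0" by (simp only: divide_le_0_iff) auto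
    then show ?thesis by simp
  qed simp
  then show ?thesis using vV by blast
qed

lemma subspace_closure:
  fixes V :: "'a::real_normed_vector set"
  assumes "subspace V"
  shows "subspace (closure V)"
proof (rule subspaceI)
  show "0 \<in> closure V" using subspace_0[OF assms] closure_subset by blast
next
  fix x y assume "x \<in> closure V" "y \<in> closure V"
  then obtain u w where "\<And>n. u n \<in> V" "u \<longlonglongrightarrow> x" "\<And>n. w n \<in> V" "w \<longlonglongrightarrow> y"
    unfolding closure_sequential by blast
  then show "x + y \<in> closure V"
    unfolding closure_sequential
    by (intro exI[of _ "\<lambda>n. u n + w n"]) (simp add: subspace_add[OF assms] tendsto_add)
next
  fix c x assume "x \<in> closure V"
  then obtain u where "\<And>n. u n \<in> V" "u \<longlonglongrightarrow> x" unfolding closure_sequential by blast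
  then show "c *\<^sub>R x \<in> closure V"
    unfolding closure_sequential
    by (intro exI[of _ "\<lambda>n. c *\<^sub>R u n"]) (simp add: subspace_scale[OF assms] tendsto_scaleR)
qed

text \<open>A residual \<open>x - v\<close> orthogonal to the range is tested against
  \<open>C (C (x - v))\<close>; symmetry turns this into \<open>C (x - v) = 0\<close>, and
  injectivity applies.\<close>

lemma symmetric_injective_dense_range:
  fixes C :: "'a::{real_inner,banach} \<Rightarrow> 'a"
  assumes "bounded_linear C" and sym: "\<And>x y. inner (C x) y = inner x (C y)"
    and inj: "\<And>x. C x = 0 \<Longrightarrow> x = 0"
  shows "closure (range C) = UNIV"
proof -
  interpret bounded_linear C by fact
  have sub: "subspace (closure (range C))"
    by (intro subspace_closure linear_subspace_image subspace_UNIV linear_axioms)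
  have "x \<in> closure (range C)" for x
  proof -
    obtain v where v: "v \<in> closure (range C)"
      and orth: "\<And>w. w \<in> closure (range C) \<Longrightarrow> inner (x - v) w = 0"
      using orthogonal_projection_exists[OF sub closed_closure, of x] by blast
    have "C (C (x - v)) \<in> closure (range C)" using closure_subset[of "range C"] by auto
    then have "inner (C (x - v)) (C (x - v)) = 0" using orth sym by metis
    then have "x - v = 0" using inj inner_eq_zero_iff by blast
    then show ?thesis using v by simp
  qed
  then show ?thesis by blast
qed

section \<open>Square roots of bounded operators by iteration\<close>

primrec sqrt_iterate :: "('a::real_normed_vector \<Rightarrow>\<^sub>L 'a) \<Rightarrow> nat \<Rightarrow> ('a \<Rightarrow>\<^sub>L 'a)" where
  "sqrt_iterate X 0 = 0"
| "sqrt_iterate X (Suc n) = (1/2) *\<^sub>R (X + (sqrt_iterate X n o\<^sub>L sqrt_iterate X n))"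

text \<open>The same recursion for the scalar \<open>X = 1\<close>, the extreme case of
  \<open>norm X \<le> 1\<close>. It increases and stays below 1, so its increments are
  summable.\<close>

primrec sqrt_majorant :: "nat \<Rightarrow> real" where
  "sqrt_majorant 0 = 0"
| "sqrt_majorant (Suc n) = (1 + (sqrt_majorant n)\<^sup>2) / 2"

lemma sqrt_majorant_bounds: "0 \<le> sqrt_majorant n \<and> sqrt_majorant n \<le> 1"
proof (induction n)
  case (Suc n)
  then have "(sqrt_majorant n)\<^sup>2 \<le> 1" by (simp add: power_le_one)
  then show ?case by simp
qed simp

lemma sqrt_majorant_mono: "sqrt_majorant n \<le> sqrt_majorant (Suc n)"
proof -
  have "0 \<le> (1 - sqrt_majorant n)\<^sup>2" by simp
  then show ?thesis by (simp add: power2_diff)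
qed

lemma norm_sqrt_iterate:
  assumes "norm X \<le> 1"
  shows "norm (sqrt_iterate X n) \<le> sqrt_majorant n"
proof (induction n)
  case (Suc n)
  have "norm (X + (sqrt_iterate X n o\<^sub>L sqrt_iterate X n))
      \<le> norm X + norm (sqrt_iterate X n) * norm (sqrt_iterate X n)"
    using norm_triangle_ineq norm_blinfun_compose by (metis add_left_mono order_trans)
  also have "\<dots> \<le> 1 + sqrt_majorant n * sqrt_majorant n"
    by (intro add_mono mult_mono assms Suc) (auto simp: sqrt_majorant_bounds)
  finally show ?case by (simp add: power2_eq_square)
qed simp

text \<open>Writing \<open>Y Y - Z Z = Y (Y - Z) + (Y - Z) Z\<close> bounds each operator increment
  by the previous one exactly as in the scalar recursion.\<close>

lemma norm_sqrt_iterate_step: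
  assumes "norm X \<le> 1"
  shows "norm (sqrt_iterate X (Suc n) - sqrt_iterate X n)
    \<le> sqrt_majorant (Suc n) - sqrt_majorant n"
proof (induction n)
  case 0
  then show ?case using assms by simp
next
  case (Suc n)
  let ?Y = "sqrt_iterate X (Suc n)" and ?Z = "sqrt_iterate X n"
  let ?y = "sqrt_majorant (Suc n)" and ?z = "sqrt_majorant n"
  have "sqrt_iterate X (Suc (Suc n)) - ?Y = (1/2) *\<^sub>R ((?Y o\<^sub>L ?Y) - (?Z o\<^sub>L ?Z))"
    by (subst (1) sqrt_iterate.simps(2), subst (3) sqrt_iterate.simps(2))
      (simp only: scaleR_diff_right[symmetric] add_diff_cancel_left)
  also have "(?Y o\<^sub>L ?Y) - (?Z o\<^sub>L ?Z) = (?Y o\<^sub>L (?Y - ?Z)) + ((?Y - ?Z) o\<^sub>L ?Z)"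
    by (rule blinfun_eqI) (simp add: blinfun.diff_left blinfun.diff_right blinfun.add_left
        del: sqrt_iterate.simps)
  also have "norm ((1/2) *\<^sub>R \<dots>) \<le> (norm ?Y * norm (?Y - ?Z) + norm (?Y - ?Z) * norm ?Z) / 2"
    using norm_triangle_mono[OF norm_blinfun_compose[of ?Y "?Y - ?Z"]
        norm_blinfun_compose[of "?Y - ?Z" ?Z]] by (simp del: sqrt_iterate.simps)
  also have "\<dots> \<le> (?y * (?y - ?z) + (?y - ?z) * ?z) / 2"
    by (intro divide_right_mono add_mono mult_mono Suc norm_sqrt_iterate assms)
      (use sqrt_majorant_bounds sqrt_majorant_mono[of n] in \<open>auto simp del: sqrt_majorant.simps(2)\<close>)
  also have "\<dots> = (1 + ?y\<^sup>2) / 2 - (1 + ?z\<^sup>2) / 2"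
    by (simp add: power2_eq_square field_simps del: sqrt_majorant.simps)
  also have "\<dots> = sqrt_majorant (Suc (Suc n)) - ?y" by simp
  finally show ?case .
qed

text \<open>The increments are dominated by a convergent telescoping series, so the iterates
  converge in operator norm, and the recursion passes to the limit.\<close>

lemma sqrt_iterate_limit:
  fixes X :: "'a::banach \<Rightarrow>\<^sub>L 'a"
  assumes "norm X \<le> 1"
  obtains Y where "sqrt_iterate X \<longlonglongrightarrow> Y" "norm Y \<le> 1" "2 *\<^sub>R Y = X + (Y o\<^sub>L Y)"
proof -
  let ?D = "\<lambda>n. sqrt_iterate X (Suc n) - sqrt_iterate X n"
  have "incseq sqrt_majorant" by (intro incseq_SucI sqrt_majorant_mono)
  then have "convergent sqrt_majorant"
    using sqrt_majorant_bounds by (metis incseq_convergent convergent_def)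
  then obtain l where "sqrt_majorant \<longlonglongrightarrow> l" by (auto simp: convergent_def)
  then have "summable (\<lambda>n. sqrt_majorant (Suc n) - sqrt_majorant n)"
    by (rule telescope_summable)
  then have "summable ?D"
    by (rule summable_comparison_test') (use norm_sqrt_iterate_step[OF assms] in blast)
  then have "convergent (\<lambda>n. \<Sum>k<n. ?D k)" by (simp only: summable_iff_convergent)
  moreover have "(\<Sum>k<n. ?D k) = sqrt_iterate X n" for n
    by (simp only: sum_lessThan_telescope) simp
  ultimately obtain Y where Y: "sqrt_iterate X \<longlonglongrightarrow> Y" by (auto simp: convergent_def)
  have "norm (sqrt_iterate X n) \<le> 1" for n
    using norm_sqrt_iterate[OF assms, of n] sqrt_majorant_bounds[of n] by linarith
  then have "norm Y \<le> 1" using Lim_bounded[OF tendsto_norm[OF Y]] by blast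
  moreover have "2 *\<^sub>R Y = X + (Y o\<^sub>L Y)"
  proof (rule LIMSEQ_unique)
    show "(\<lambda>n. 2 *\<^sub>R sqrt_iterate X (Suc n)) \<longlonglongrightarrow> 2 *\<^sub>R Y"
      by (intro tendsto_intros LIMSEQ_Suc Y)
    have "(\<lambda>n. X + (sqrt_iterate X n o\<^sub>L sqrt_iterate X n)) \<longlonglongrightarrow> X + (Y o\<^sub>L Y)"
      by (intro tendsto_add tendsto_const bounded_bilinear.tendsto[OF bounded_bilinear_blinfun_compose] Y)
    then show "(\<lambda>n. 2 *\<^sub>R sqrt_iterate X (Suc n)) \<longlonglongrightarrow> X + (Y o\<^sub>L Y)" by simp
  qed
  ultimately show thesis using that Y by blast
qed

lemma sqrt_iterate_symmetric:
  fixes X :: "'a::real_inner \<Rightarrow>\<^sub>L 'a"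
  assumes "\<And>x y. inner (X x) y = inner x (X y)"
  shows "inner (sqrt_iterate X n x) y = inner x (sqrt_iterate X n y)"
  using assms
  by (induction n arbitrary: x y)
    (auto simp: blinfun.add_left blinfun.scaleR_left inner_add_left inner_add_right)

text \<open>The iterates are polynomials in \<open>X\<close>. Only real linearity of
  \<open>R\<close> is asked, so that \<open>R\<close> may be multiplication by a complex scalar or
  any bounded operator.\<close>

lemma sqrt_iterate_commute:
  assumes "bounded_linear R" "\<And>x. R (blinfun_apply X x) = X (R x)"
  shows "R (sqrt_iterate X n x) = sqrt_iterate X n (R x)"
proof -
  interpret bounded_linear R by fact
  show ?thesis
    by (induction n arbitrary: x)
      (auto simp: blinfun.add_left blinfun.scaleR_left add scale zero assms(2))
qed

text \<open>
  The bound on \<open>I - C\<close> is what allows taking a square root of \<open>C\<close> in turn, from which positivity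
  of \<open>C\<close> follows.
\<close>

definition is_positive_sqrt :: "('a::real_inner \<Rightarrow> 'a) \<Rightarrow> ('a \<Rightarrow> 'a) \<Rightarrow> bool" where
  "is_positive_sqrt B C \<longleftrightarrow> bounded_linear C \<and> (\<forall>x y. inner (C x) y = inner x (C y))
    \<and> (\<forall>x. C (C x) = B x) \<and> (\<forall>x. norm (x - C x) \<le> norm x)
    \<and> (\<forall>R. bounded_linear R \<longrightarrow> (\<forall>x. R (B x) = B (R x)) \<longrightarrow> (\<forall>x. R (C x) = C (R x)))"

lemma is_positive_sqrtD:
  assumes "is_positive_sqrt B C"
  shows "bounded_linear C" "inner (C x) y = inner x (C y)" "C (C x) = B x"
    "norm (x - C x) \<le> norm x"
    "bounded_linear R \<Longrightarrow> (\<And>x. R (B x) = B (R x)) \<Longrightarrow> R (C x) = C (R x)"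
  using assms by (auto simp: is_positive_sqrt_def)

text \<open>With \<open>X = I - B\<close>, the fixed point equation says
  \<open>(I - Y) (I - Y) = I - X = B\<close>. Symmetry and commutation pass from the iterates to
  their pointwise limit, and \<open>norm Y \<le> 1\<close> is the bound on
  \<open>I - C\<close>.\<close>

lemma positive_sqrt_exists:
  fixes B :: "'a::{real_inner,banach} \<Rightarrow> 'a"
  assumes B: "bounded_linear B" and sym: "\<And>x y. inner (B x) y = inner x (B y)"
    and contr: "\<And>x. norm (x - B x) \<le> norm x"
  shows "\<exists>C. is_positive_sqrt B C"
proof -
  define X where "X = Blinfun (\<lambda>x. x - B x)"
  have X: "blinfun_apply X x = x - B x" for x
    unfolding X_def by (simp add: bounded_linear_Blinfun_apply bounded_linear_sub B bounded_linear_ident)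
  have "norm X \<le> 1" by (rule norm_blinfun_bound) (simp_all add: X contr)
  then obtain Y where lim: "sqrt_iterate X \<longlonglongrightarrow> Y" and nY: "norm Y \<le> 1"
    and eq: "2 *\<^sub>R Y = X + (Y o\<^sub>L Y)"
    by (rule sqrt_iterate_limit)
  have limx: "(\<lambda>n. sqrt_iterate X n x) \<longlonglongrightarrow> Y x" for x
    by (intro blinfun.tendsto lim tendsto_const)
  define C where "C = (\<lambda>x. x - Y x)"
  have "is_positive_sqrt B C"
    unfolding is_positive_sqrt_def
  proof (intro conjI allI impI)
    show "bounded_linear C"
      unfolding C_def
      by (intro bounded_linear_sub bounded_linear_ident blinfun.bounded_linear_right)
    have "inner (Y x) y = inner x (Y y)" for x y
    proof (rule LIMSEQ_unique)
      show "(\<lambda>n. inner (sqrt_iterate X n x) y) \<longlonglongrightarrow> inner (Y x) y"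
        by (intro tendsto_intros limx)
      have "(\<lambda>n. inner x (sqrt_iterate X n y)) \<longlonglongrightarrow> inner x (Y y)"
        by (intro tendsto_intros limx)
      then show "(\<lambda>n. inner (sqrt_iterate X n x) y) \<longlonglongrightarrow> inner x (Y y)"
        by (subst sqrt_iterate_symmetric) (simp_all add: X inner_diff_left inner_diff_right sym)
    qed
    then show "inner (C x) y = inner x (C y)" for x y
      by (simp add: C_def inner_diff_left inner_diff_right)
    show "C (C x) = B x" for x
    proof -
      have "2 *\<^sub>R Y x = x - B x + Y (Y x)"
        using arg_cong[OF eq, of "\<lambda>Z. blinfun_apply Z x"]
        by (simp add: blinfun.scaleR_left blinfun.add_left X)
      then show ?thesis
        by (simp add: C_def blinfun.diff_right scaleR_2 algebra_simps)
    qed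
    show "norm (x - C x) \<le> norm x" for x
      using norm_blinfun[of Y x] mult_right_mono[OF nY, of "norm x"] by (simp add: C_def)
    show "R (C x) = C (R x)" if R: "bounded_linear R" and comm: "\<forall>x. R (B x) = B (R x)" for R x
    proof -
      interpret R: bounded_linear R by (rule R)
      have "R (Y x) = Y (R x)"
      proof (rule LIMSEQ_unique)
        show "(\<lambda>n. R (sqrt_iterate X n x)) \<longlonglongrightarrow> R (Y x)"
          by (intro R.tendsto limx)
        show "(\<lambda>n. R (sqrt_iterate X n x)) \<longlonglongrightarrow> Y (R x)"
          using limx[of "R x"]
          by (subst sqrt_iterate_commute) (simp_all add: R X R.diff comm)
      qed
      then show ?thesis by (simp add: C_def R.diff)
    qed
  qed
  then show ?thesis by blast
qed

text \<open>\<open>C\<close> meets the hypotheses of \<open>positive_sqrt_exists\<close> itself, so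
  \<open>C = D D\<close> with \<open>D\<close> symmetric, and the quadratic form of \<open>C\<close>
  is the squared norm of \<open>D x\<close>.\<close>

lemma positive_sqrt_nonneg:
  fixes B :: "'a::{real_inner,banach} \<Rightarrow> 'a"
  assumes "is_positive_sqrt B C"
  shows "0 \<le> inner x (C x)" "inner x (C x) = 0 \<Longrightarrow> C x = 0"
proof -
  note C = is_positive_sqrtD[OF assms]
  obtain D where D: "is_positive_sqrt C D"
    using positive_sqrt_exists[OF C(1,2,4)] by blast
  have eq: "inner x (C x) = inner (D x) (D x)"
    by (simp only: is_positive_sqrtD(2,3)[OF D])
  show "0 \<le> inner x (C x)" by (simp add: eq)
  assume "inner x (C x) = 0"
  then have "D x = 0" by (simp add: eq)
  then show "C x = 0"
    using is_positive_sqrtD(3)[OF D, of x] linear_0[OF bounded_linear.linear[OF is_positive_sqrtD(1)[OF D]]] by simp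
qed

text \<open>\<open>Q\<close> commutes with \<open>B = Q Q\<close>, hence with \<open>C\<close>. So
  \<open>C + Q\<close> kills \<open>y = C x - Q x\<close>; two nonnegative forms summing to zero
  both vanish, which gives \<open>C y = 0\<close>, then \<open>B y = 0\<close>.\<close>

lemma positive_sqrt_unique:
  fixes B :: "'a::{real_inner,banach} \<Rightarrow> 'a"
  assumes B_inj: "\<And>x. B x = 0 \<Longrightarrow> x = 0" and C: "is_positive_sqrt B C"
    and Q: "bounded_linear Q" "\<And>x. 0 \<le> inner x (Q x)" "\<And>x. Q (Q x) = B x"
  shows "C = Q"
proof
  fix x
  note C = is_positive_sqrtD[OF C] positive_sqrt_nonneg[OF C]
  interpret C: bounded_linear C by (rule C(1))
  interpret Q: bounded_linear Q by (rule Q(1))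
  have comm: "Q (C x) = C (Q x)"
    by (rule C(5)[OF Q(1)]) (simp add: Q(3)[symmetric])
  define y where "y = C x - Q x"
  have "C y + Q y = 0"
    by (simp add: y_def C.diff Q.diff C(3) Q(3) comm)
  then have "inner y (C y) + inner y (Q y) = 0" by (simp add: inner_add_right[symmetric])
  then have "inner y (C y) = 0" using C(6)[of y] Q(2)[of y] by linarith
  then have "C y = 0" by (rule C(7))
  then have "B y = 0" using C(3)[of y] C.zero by simp
  then have "y = 0" by (rule B_inj)
  then show "C x = Q x" by (simp add: y_def)
qed

section \<open>Complex Hilbert spaces and adjoints\<close>

text \<open>The real inner product determines the complex one, so most of the argument can run on
  \<open>inner\<close> alone.\<close>

lemma Im_cinner: "Im (cinner x y) = inner x ((- \<i>) *\<^sub>C y)"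
  unfolding Re_cinner[symmetric] cinner_scaleC_right by simp

lemma cinner_scaleC_left: "cinner (c *\<^sub>C x) y = cnj c * cinner x y"
  by (metis cinner_commute cinner_scaleC_right complex_cnj_mult)

lemma norm_scaleC: "norm (c *\<^sub>C x) = cmod c * norm x"
proof -
  have "complex_of_real ((norm (c *\<^sub>C x))\<^sup>2) = (c * cnj c) * cinner x x"
    unfolding cinner_self[symmetric]
    by (simp add: cinner_scaleC_left cinner_scaleC_right mult_ac)
  also have "\<dots> = complex_of_real ((cmod c * norm x)\<^sup>2)"
    by (simp add: cinner_self complex_norm_square[symmetric] power_mult_distrib)
  finally have "complex_of_real ((norm (c *\<^sub>C x))\<^sup>2) = complex_of_real ((cmod c * norm x)\<^sup>2)" .
  then have "(norm (c *\<^sub>C x))\<^sup>2 = (cmod c * norm x)\<^sup>2" using of_real_eq_iff by blast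
  then show ?thesis by (simp add: power2_eq_iff_nonneg)
qed

text \<open>Makes complex scaling an admissible \<open>R\<close> in the commutation lemmas, from
  which \<open>B\<close> and \<open>C\<close> inherit complex homogeneity.\<close>

lemma bounded_linear_scaleC: "bounded_linear ((*\<^sub>C) c :: 'a \<Rightarrow> 'a::complex_hilbert_space)"
proof (rule bounded_linear_intro)
  show "c *\<^sub>C r *\<^sub>R x = r *\<^sub>R c *\<^sub>C x" for r and x :: 'a
    by (simp add: scaleC_of_real[symmetric] scaleC_scaleC mult.commute)
  show "norm (c *\<^sub>C x) \<le> norm x * cmod c" for x :: 'a by (simp add: norm_scaleC mult.commute)
qed (rule scaleC_add_right)

lemma inner_dense_eqI:
  fixes x y :: "'a::real_inner"
  assumes "closure D = UNIV" "\<And>w. w \<in> D \<Longrightarrow> inner x w = inner y w"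
  shows "x = y"
proof -
  have "x - y \<in> closure D" using assms(1) by simp
  then obtain w where w: "\<And>n. w n \<in> D" "w \<longlonglongrightarrow> x - y" unfolding closure_sequential by blast
  have "(\<lambda>n. inner (x - y) (w n)) \<longlonglongrightarrow> inner (x - y) (x - y)" by (intro tendsto_intros w)
  moreover have "inner (x - y) (w n) = 0" for n using assms(2)[OF w(1)] by (simp add: inner_diff_left)
  ultimately have "inner (x - y) (x - y) = 0" by (simp add: LIMSEQ_const_iff)
  then show ?thesis by simp
qed

text \<open>Since \<open>dom T\<close> is closed under multiplication by \<open>- \<i>\<close>, the
  real condition already implies the complex one. Density makes \<open>z\<close> unique, so
  \<open>THE\<close> denotes it.\<close>

lemma op_adjoint_eq_Some:
  fixes T :: "'a::complex_hilbert_space operator"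
  assumes "densely_defined T"
  shows "op_adjoint T x = Some z \<longleftrightarrow> (\<forall>y v. T y = Some v \<longrightarrow> inner x v = inner z y)"
proof -
  let ?P = "\<lambda>z. \<forall>y v. T y = Some v \<longrightarrow> cinner x v = cinner z y"
  have T: "linear_op T" "closure (dom T) = UNIV" using assms by (auto simp: densely_defined_def)
  have P: "?P z \<longleftrightarrow> (\<forall>y v. T y = Some v \<longrightarrow> inner x v = inner z y)" for z
  proof
    assume "?P z"
    then have "Re (cinner x v) = Re (cinner z y)" if "T y = Some v" for y v
      using that by metis
    then show "\<forall>y v. T y = Some v \<longrightarrow> inner x v = inner z y" unfolding Re_cinner by blast
  next
    assume R: "\<forall>y v. T y = Some v \<longrightarrow> inner x v = inner z y"
    show "?P z"
    proof (intro allI impI)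
      fix y v assume yv: "T y = Some v"
      then have "T ((- \<i>) *\<^sub>C y) = Some ((- \<i>) *\<^sub>C v)" using T(1) unfolding linear_op_def by blast
      with R yv show "cinner x v = cinner z y" by (intro complex_eqI) (simp_all only: Re_cinner Im_cinner)
    qed
  qed
  have uniq: "z = z'" if z: "?P z" "?P z'" for z z'
  proof (rule inner_dense_eqI[OF T(2)])
    fix w assume "w \<in> dom T"
    then obtain v where "T w = Some v" by blast
    then have "cinner z w = cinner z' w" using z by metis
    then show "inner z w = inner z' w" by (simp only: Re_cinner[symmetric])
  qed
  have "op_adjoint T x = Some z \<longleftrightarrow> ?P z"
  proof
    assume "op_adjoint T x = Some z"
    then have "\<exists>z. ?P z" and z: "z = (THE z. ?P z)" by (auto simp: op_adjoint_def split: if_splits)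
    then have "\<exists>!z. ?P z" using uniq by blast
    from theI'[OF this] show "?P z" unfolding z .
  next
    assume "?P z"
    moreover from this have "(THE z. ?P z) = z" by (rule the_equality) (use uniq \<open>?P z\<close> in blast)
    ultimately show "op_adjoint T x = Some z" by (auto simp: op_adjoint_def)
  qed
  with P show ?thesis by simp
qed

lemma op_inverse_eq_Some:
  assumes "\<And>x x' y. T x = Some y \<Longrightarrow> T x' = Some y \<Longrightarrow> x = x'"
  shows "op_inverse T y = Some x \<longleftrightarrow> T x = Some y"
proof
  assume "op_inverse T y = Some x"
  then have "y \<in> ran T" and x: "x = (THE x. T x = Some y)"
    by (auto simp: op_inverse_def split: if_splits)
  then have "\<exists>!x. T x = Some y" using assms by (auto simp: ran_def)
  from theI'[OF this] show "T x = Some y" unfolding x .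
next
  assume "T x = Some y"
  then show "op_inverse T y = Some x"
    using assms by (auto simp: op_inverse_def ran_def intro!: the_equality)
qed

lemma operator_eqI:
  fixes X Y :: "'a operator"
  assumes "\<And>x z. X x = Some z \<longleftrightarrow> Y x = Some z"
  shows "X = Y"
proof
  show "X x = Y x" for x
  proof (cases "Y x")
    case None
    then show ?thesis using assms[of x "the (X x)"] by (cases "X x") simp_all
  next
    case (Some z)
    then show ?thesis using assms[of x z] by simp
  qed
qed

lemma densely_defined_total_op:
  assumes "R \<in> bounded_ops"
  shows "densely_defined (total_op R)"
proof -
  interpret bounded_linear R using assms by (simp add: bounded_ops_def)
  show ?thesis
    using assms zero add
    by (auto simp: densely_defined_def linear_op_def total_op_def bounded_ops_def dom_def)
qed

section \<open>The bounded transform of a self-adjoint operator\<close>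

locale selfadjoint_operator =
  fixes T :: "'a::complex_hilbert_space operator"
  assumes selfadjoint: "selfadjoint_op T"
begin

lemma linear: "linear_op T" and dense: "closure (dom T) = UNIV"
  using selfadjoint by (auto simp: selfadjoint_op_def densely_defined_def)

lemma T_zero: "T 0 = Some 0"
  using linear by (simp add: linear_op_def)

lemma T_add: "T x = Some u \<Longrightarrow> T y = Some v \<Longrightarrow> T (x + y) = Some (u + v)"
  using linear by (simp add: linear_op_def)

lemma T_scaleC: "T x = Some u \<Longrightarrow> T (c *\<^sub>C x) = Some (c *\<^sub>C u)"
  using linear by (simp add: linear_op_def)

lemma T_scaleR: "T x = Some u \<Longrightarrow> T (r *\<^sub>R x) = Some (r *\<^sub>R u)"
  using T_scaleC[of x u "complex_of_real r"] by (simp only: scaleC_of_real)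

lemma T_diff: "T x = Some u \<Longrightarrow> T y = Some v \<Longrightarrow> T (x - y) = Some (u - v)"
  using T_add[OF _ T_scaleR[of y v "-1"]] by simp

text \<open>Read from right to left, this is a weak test for membership in \<open>dom T\<close>;
  \<open>T_closed\<close> and \<open>inverse_exists\<close> rest on it.\<close>

lemma T_eq_Some: "T x = Some z \<longleftrightarrow> (\<forall>y v. T y = Some v \<longrightarrow> inner x v = inner z y)"
  using selfadjoint op_adjoint_eq_Some[of T x z] by (simp add: selfadjoint_op_def)

lemma T_symmetric: "T x = Some u \<Longrightarrow> T y = Some v \<Longrightarrow> inner x v = inner u y"
  by (rule T_eq_Some[THEN iffD1, rule_format])

lemma T_closed:
  assumes "\<And>n. T (x n) = Some (u n)" "x \<longlonglongrightarrow> x'" "u \<longlonglongrightarrow> u'"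
  shows "T x' = Some u'"
proof (rule T_eq_Some[THEN iffD2], intro allI impI)
  fix y v assume "T y = Some v"
  then have eq: "inner (x n) v = inner (u n) y" for n by (rule T_symmetric[OF assms(1)])
  show "inner x' v = inner u' y"
  proof (rule LIMSEQ_unique)
    show "(\<lambda>n. inner (u n) y) \<longlonglongrightarrow> inner u' y"
      by (rule tendsto_inner[OF assms(3) tendsto_const])
    show "(\<lambda>n. inner (u n) y) \<longlonglongrightarrow> inner x' v"
      using tendsto_inner[OF assms(2) tendsto_const[of v]] by (simp add: eq)
  qed
qed

section \<open>The graph of T and the bounded inverse of I + T^2\<close>

lemma closed_graph: "closed (Map.graph T)"
  unfolding closed_sequential_limits
proof (intro allI impI)
  fix p l assume "(\<forall>n. p n \<in> Map.graph T) \<and> p \<longlonglongrightarrow> l"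
  then have "T (fst (p n)) = Some (snd (p n))" and p: "p \<longlonglongrightarrow> l" for n
    by (auto intro: in_graphD)
  from this(1) have "T (fst l) = Some (snd l)"
    by (rule T_closed[OF _ tendsto_fst[OF p] tendsto_snd[OF p]])
  then show "l \<in> Map.graph T" using in_graphI[of T "fst l" "snd l"] by simp
qed

lemma subspace_graph: "subspace (Map.graph T)"
proof (rule subspaceI)
  show "0 \<in> Map.graph T" unfolding zero_prod_def by (rule in_graphI[of T, OF T_zero])
next
  fix p q assume "p \<in> Map.graph T" "q \<in> Map.graph T"
  then have "T (fst p + fst q) = Some (snd p + snd q)"
    by (intro T_add) (auto intro: in_graphD)
  then show "p + q \<in> Map.graph T" unfolding plus_prod_def by (rule in_graphI[of T])
next
  fix c p assume "p \<in> Map.graph T"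
  then have "T (c *\<^sub>R fst p) = Some (c *\<^sub>R snd p)"
    by (intro T_scaleR) (auto intro: in_graphD)
  then show "c *\<^sub>R p \<in> Map.graph T" unfolding scaleR_prod_def by (rule in_graphI[of T])
qed

text \<open>If \<open>(y, u)\<close> is the projection of \<open>(x, 0)\<close>, the residual
  \<open>(x - y, - u)\<close> is orthogonal to the graph. That is the weak form of
  \<open>T u = Some (x - y)\<close>.\<close>

lemma inverse_exists: "\<exists>y u v. T y = Some u \<and> T u = Some v \<and> y + v = x"
proof -
  obtain p where p: "p \<in> Map.graph T"
    and orth: "\<And>q. q \<in> Map.graph T \<Longrightarrow> inner ((x, 0) - p) q = 0"
    using orthogonal_projection_exists[OF subspace_graph closed_graph, of "(x, 0)"] by blast
  obtain y u where yu: "p = (y, u)" "T y = Some u"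
    using p by (cases p) (auto dest: in_graphD)
  have "inner u z = inner (x - y) w" if "T w = Some z" for w z
    using orth[OF in_graphI[of T, OF that]] by (simp add: yu(1))
  then have "T u = Some (x - y)"
    by (intro iffD2[OF T_eq_Some] allI impI)
  then show ?thesis using yu(2) by (intro exI[of _ y] exI[of _ u] exI[of _ "x - y"]) simp
qed

lemma norm_inverse:
  assumes "T y = Some u" "T u = Some v"
  shows "inner y (y + v) = (norm y)\<^sup>2 + (norm u)\<^sup>2"
  using T_symmetric[OF assms] by (simp add: inner_add_right power2_norm_eq_inner)

definition B :: "'a \<Rightarrow> 'a" where
  "B x = (THE y. \<exists>u v. T y = Some u \<and> T u = Some v \<and> y + v = x)"

text \<open>For the difference of two solutions, \<open>norm_inverse\<close> equates 0 with a sum of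
  squares.\<close>

lemma inverse_unique:
  assumes "T y = Some u" "T u = Some v" "T y' = Some u'" "T u' = Some v'" "y + v = y' + v'"
  shows "y = y'"
proof -
  have "inner (y - y') ((y - y') + (v - v')) = (norm (y - y'))\<^sup>2 + (norm (u - u'))\<^sup>2"
    by (intro norm_inverse T_diff assms)
  also have "(y - y') + (v - v') = 0" using assms(5) by (simp add: algebra_simps)
  finally show ?thesis by (simp add: sum_power2_eq_zero_iff)
qed

lemma B_eq:
  assumes "T y = Some u" "T u = Some v"
  shows "B (y + v) = y"
  unfolding B_def using assms inverse_unique by (intro the_equality) blast+

lemma B_obtain:
  obtains u v where "T (B x) = Some u" "T u = Some v" "B x + v = x"
  using inverse_exists[of x] B_eq by metis

lemma B_symmetric: "inner (B x) y = inner x (B y)"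
proof -
  obtain u v where 1: "T (B x) = Some u" "T u = Some v" "B x + v = x" by (rule B_obtain)
  obtain u' v' where 2: "T (B y) = Some u'" "T u' = Some v'" "B y + v' = y" by (rule B_obtain)
  have "inner (B x) v' = inner v (B y)"
    using T_symmetric[OF 1(1) 2(2)] T_symmetric[OF 1(2) 2(1)] by simp
  then have "inner (B x) (B y + v') = inner (B x + v) (B y)"
    by (simp add: inner_add_left inner_add_right)
  then show ?thesis using 1(3) 2(3) by simp
qed

lemma B_injective:
  assumes "B x = 0"
  shows "x = 0"
proof -
  obtain u v where "T (B x) = Some u" "T u = Some v" "B x + v = x" by (rule B_obtain)
  then show ?thesis using assms T_zero by simp
qed

text \<open>Expanding \<open>x = B x + v\<close> gives the squared norms of \<open>B x\<close> and
  \<open>v\<close> plus twice that of \<open>u\<close>, as the cross term is nonnegative by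
  symmetry. The second bound is what \<open>positive_sqrt_exists\<close> requires.\<close>

lemma B_estimates: "norm (B x) \<le> norm x" "norm (x - B x) \<le> norm x"
proof -
  obtain u v where uv: "T (B x) = Some u" "T u = Some v" "B x + v = x" by (rule B_obtain)
  have "inner (B x) v = (norm u)\<^sup>2"
    using T_symmetric[OF uv(1,2)] by (simp add: power2_norm_eq_inner)
  then have "(norm (B x + v))\<^sup>2 = (norm (B x))\<^sup>2 + 2 * (norm u)\<^sup>2 + (norm v)\<^sup>2"
    unfolding power2_norm_eq_inner by (simp add: inner_add_left inner_add_right inner_commute)
  then have eq: "(norm x)\<^sup>2 = (norm (B x))\<^sup>2 + 2 * (norm u)\<^sup>2 + (norm v)\<^sup>2"
    using uv(3) by simp
  show "norm (B x) \<le> norm x" by (rule power2_le_imp_le) (simp_all add: eq)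
  have "norm v \<le> norm x" by (rule power2_le_imp_le) (simp_all add: eq)
  moreover have "v = x - B x" using uv(3) by (simp add: algebra_simps)
  ultimately show "norm (x - B x) \<le> norm x" by simp
qed

lemma B_add: "B (x + y) = B x + B y"
proof -
  obtain u v where 1: "T (B x) = Some u" "T u = Some v" "B x + v = x" by (rule B_obtain)
  obtain u' v' where 2: "T (B y) = Some u'" "T u' = Some v'" "B y + v' = y" by (rule B_obtain)
  have "B ((B x + B y) + (v + v')) = B x + B y" by (rule B_eq[OF T_add[OF 1(1) 2(1)] T_add[OF 1(2) 2(2)]])
  moreover have "(B x + B y) + (v + v') = x + y" using 1(3) 2(3) by (metis add.assoc add.left_commute)
  ultimately show ?thesis by simp
qed

text \<open>\<open>R\<close> carries the solution \<open>B x\<close>, \<open>u\<close>,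
  \<open>v\<close> for \<open>x\<close> to a solution for \<open>R x\<close>, and solutions are
  unique.\<close>

lemma B_commute:
  assumes R: "bounded_linear R" and comm: "\<And>x u. T x = Some u \<Longrightarrow> T (R x) = Some (R u)"
  shows "R (B x) = B (R x)"
proof -
  interpret bounded_linear R by (rule R)
  obtain u v where "T (B x) = Some u" "T u = Some v" "B x + v = x" by (rule B_obtain)
  then show ?thesis using B_eq[OF comm comm] add by metis
qed

lemma B_scaleC: "B (c *\<^sub>C x) = c *\<^sub>C B x"
  using B_commute[OF bounded_linear_scaleC T_scaleC] by simp

lemma bounded_linear_B: "bounded_linear B"
proof (rule bounded_linear_intro)
  show "norm (B x) \<le> norm x * 1" for x using B_estimates by simp
  show "B (r *\<^sub>R x) = r *\<^sub>R B x" for r x using B_scaleC by (metis scaleC_of_real)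
qed (rule B_add)

section \<open>The square root C of (I + T^2)^-1 and the bounded operator S = T C\<close>

definition C :: "'a \<Rightarrow> 'a" where
  "C = (SOME C. is_positive_sqrt B C)"

lemma C_sqrt: "is_positive_sqrt B C"
  unfolding C_def
  by (rule someI_ex[OF positive_sqrt_exists[OF bounded_linear_B B_symmetric B_estimates(2)]])

lemmas bounded_linear_C = is_positive_sqrtD(1)[OF C_sqrt]
  and C_symmetric = is_positive_sqrtD(2)[OF C_sqrt]
  and C_C = is_positive_sqrtD(3)[OF C_sqrt]
  and C_commute = is_positive_sqrtD(5)[OF C_sqrt]
  and C_nonneg = positive_sqrt_nonneg(1)[OF C_sqrt]

lemma C_scaleC: "C (c *\<^sub>C x) = c *\<^sub>C C x"
  using C_commute[OF bounded_linear_scaleC B_scaleC[symmetric]] by simp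

interpretation B: bounded_linear B by (rule bounded_linear_B)

interpretation C: bounded_linear C by (rule bounded_linear_C)

lemma C_injective: "C x = 0 \<Longrightarrow> x = 0"
  using B_injective[of x] C_C[of x] C.zero by simp

lemma C_eq_iff: "C x = C y \<longleftrightarrow> x = y"
  using C_injective[of "x - y"] by (auto simp: C.diff)

lemma dense_range_C: "closure (range C) = UNIV"
  by (rule symmetric_injective_dense_range[OF bounded_linear_C C_symmetric C_injective])

text \<open>Since \<open>B y = C (C y)\<close>, this says that \<open>T C\<close> is a contraction
  on the range of \<open>C\<close>. It holds because the squared norm of \<open>C y\<close> is
  \<open>inner (B y) y\<close>.\<close>

lemma norm_T_B:
  assumes "T (B y) = Some u" shows "norm u \<le> norm (C y)"
proof (rule power2_le_imp_le)
  obtain u' v where u': "T (B y) = Some u'" "T u' = Some v" "B y + v = y" by (rule B_obtain)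
  with assms have uv: "T u = Some v" "B y + v = y" by simp_all
  have "inner (B y) y = (norm (B y))\<^sup>2 + (norm u)\<^sup>2"
    using norm_inverse[OF assms uv(1)] uv(2) by simp
  moreover have "inner (B y) y = (norm (C y))\<^sup>2"
    by (simp only: power2_norm_eq_inner C_symmetric C_C inner_commute[of "B y"])
  ultimately show "(norm u)\<^sup>2 \<le> (norm (C y))\<^sup>2" by simp
qed simp

text \<open>Approximating \<open>x\<close> by \<open>w n = C (y n)\<close>, the contraction bound
  makes the images under \<open>T C\<close> Cauchy; closedness of \<open>T\<close> then puts
  \<open>C x\<close> in its domain.\<close>

lemma T_C_exists: "\<exists>s. T (C x) = Some s \<and> norm s \<le> norm x"
proof -
  have "x \<in> closure (range C)" using dense_range_C by simp
  then obtain w where "\<And>n. w n \<in> range C" and w: "w \<longlonglongrightarrow> x" unfolding closure_sequential by blast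
  then have "\<exists>y. w n = C y" for n by blast
  then obtain y where y: "\<And>n. w n = C (y n)" by metis
  have "\<exists>u. T (B (y n)) = Some u" for n by (rule B_obtain[of "y n"]) blast
  then obtain u where u: "\<And>n. T (B (y n)) = Some (u n)" by metis
  have "Cauchy u"
  proof (rule metric_CauchyI)
    fix e :: real assume "0 < e"
    then obtain M where M: "\<And>m n. M \<le> m \<Longrightarrow> M \<le> n \<Longrightarrow> dist (w m) (w n) < e"
      using metric_CauchyD[OF LIMSEQ_imp_Cauchy[OF w]] by blast
    have le: "dist (u m) (u n) \<le> dist (w m) (w n)" for m n
    proof -
      have "T (B (y m - y n)) = Some (u m - u n)"
        using T_diff[OF u[of m] u[of n]] by (simp only: B.diff)
      then have "norm (u m - u n) \<le> norm (C (y m - y n))" by (rule norm_T_B)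
      then show ?thesis by (simp add: dist_norm y C.diff)
    qed
    show "\<exists>M. \<forall>m\<ge>M. \<forall>n\<ge>M. dist (u m) (u n) < e"
      by (intro exI[of _ M] allI impI le_less_trans[OF le M])
  qed
  then obtain s where s: "u \<longlonglongrightarrow> s" using Cauchy_convergent convergent_def by blast
  have Cw: "C (w n) = B (y n)" for n by (simp add: y C_C)
  have "T (C x) = Some s"
    by (rule T_closed[OF _ C.tendsto[OF w] s]) (simp only: Cw u)
  moreover have "norm (u n) \<le> norm (w n)" for n unfolding y by (rule norm_T_B[OF u])
  then have "norm s \<le> norm x"
    by (intro LIMSEQ_le[OF tendsto_norm[OF s] tendsto_norm[OF w]] exI[of _ 0]) simp
  ultimately show ?thesis by blast
qed

definition S :: "'a \<Rightarrow> 'a" where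
  "S x = the (T (C x))"

lemma T_C: "T (C x) = Some (S x)" and norm_S: "norm (S x) \<le> norm x"
  using T_C_exists[of x] by (auto simp: S_def)

lemma S_bounded_ops: "S \<in> bounded_ops"
proof -
  have "S (x + y) = S x + S y" for x y
    using T_add[OF T_C T_C, of x y] T_C[of "x + y"] by (simp add: C.add)
  moreover have scaleC: "S (c *\<^sub>C x) = c *\<^sub>C S x" for c x
    using T_scaleC[OF T_C, of c x] T_C[of "c *\<^sub>C x"] by (simp add: C_scaleC)
  moreover have "S (r *\<^sub>R x) = r *\<^sub>R S x" for r x
    using scaleC by (metis scaleC_of_real)
  ultimately show ?thesis
    using norm_S by (auto simp: bounded_ops_def intro!: bounded_linear_intro[where K = 1])
qed

section \<open>The square root of I + T^2 and its uniqueness\<close>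

abbreviation (input) I_plus_T2 :: "'a operator" where
  "I_plus_T2 \<equiv> op_add (total_op id) (T \<circ>\<^sub>m T)"

text \<open>Identifies \<open>I_plus_T2\<close>, natural domain included, with the inverse of
  \<open>B\<close>.\<close>

lemma I_plus_T2_eq_Some: "I_plus_T2 x = Some z \<longleftrightarrow> x = B z"
proof
  assume "I_plus_T2 x = Some z"
  then obtain u v where "T x = Some u" "T u = Some v" "x + v = z"
    by (auto simp: op_add_def total_op_def map_comp_def split: option.splits)
  then show "x = B z" using B_eq by metis
next
  assume x: "x = B z"
  obtain u v where "T (B z) = Some u" "T u = Some v" "B z + v = z" by (rule B_obtain)
  then show "I_plus_T2 x = Some z" by (simp add: x op_add_def total_op_def map_comp_def)
qed

abbreviation (input) R0 :: "'a operator" where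
  "R0 \<equiv> op_inverse (total_op C)"

lemma R0_eq_Some: "R0 x = Some z \<longleftrightarrow> x = C z"
  by (subst op_inverse_eq_Some) (auto simp: total_op_def C_eq_iff)

text \<open>Symmetry of \<open>C\<close> and conjugate symmetry make the imaginary part its own
  negative. The arguments are in this order because \<open>R0\<close> sends \<open>C z\<close> to
  \<open>z\<close>.\<close>

lemma cinner_C_nonneg: "cinner (C z) z \<in> \<real>\<^sub>\<ge>\<^sub>0"
proof -
  have "Im (cinner (C z) z) = inner z ((- \<i>) *\<^sub>C C z)"
    by (simp only: Im_cinner C_symmetric C_scaleC)
  also have "\<dots> = Im (cinner z (C z))" by (simp only: Im_cinner)
  also have "\<dots> = - Im (cinner (C z) z)" by (metis cinner_commute cnj.simps(2))
  finally have "Im (cinner (C z) z) = 0" by simp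
  moreover have "0 \<le> Re (cinner (C z) z)" using C_nonneg by (simp add: Re_cinner inner_commute)
  ultimately show ?thesis by (simp add: complex_nonneg_Reals_iff)
qed

lemma R0_sqrt: "selfadjoint_op R0 \<and> positive_op R0 \<and> R0 \<circ>\<^sub>m R0 = I_plus_T2"
proof (intro conjI)
  have "dom R0 = range C" using R0_eq_Some by (auto simp: dom_def)
  moreover have "linear_op R0"
    unfolding linear_op_def by (auto simp: R0_eq_Some C.zero C.add C_scaleC)
  ultimately have dense: "densely_defined R0" by (simp add: densely_defined_def dense_range_C)
  have "op_adjoint R0 x = Some z \<longleftrightarrow> R0 x = Some z" for x z
  proof -
    have "op_adjoint R0 x = Some z \<longleftrightarrow> (\<forall>v. inner x v = inner (C z) v)"
      \<comment> \<open>The domain of \<open>R0\<close> consists of the vectors \<open>C v\<close>,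
        and \<open>C\<close> moves across to \<open>z\<close>, so the test runs over all
        \<open>v\<close>.\<close>
      by (simp add: op_adjoint_eq_Some[OF dense] R0_eq_Some C_symmetric)
    also have "\<dots> \<longleftrightarrow> x = C z" by (rule vector_eq_rdot)
    finally show ?thesis by (simp add: R0_eq_Some)
  qed
  then have "op_adjoint R0 = R0" by (rule operator_eqI)
  with dense show "selfadjoint_op R0" by (simp only: selfadjoint_op_def)
  show "positive_op R0"
    unfolding positive_op_def using cinner_C_nonneg by (simp add: R0_eq_Some)
  have "(R0 \<circ>\<^sub>m R0) x = Some z \<longleftrightarrow> I_plus_T2 x = Some z" for x z
    by (auto simp: map_comp_Some_iff R0_eq_Some I_plus_T2_eq_Some C_C)
  then show "R0 \<circ>\<^sub>m R0 = I_plus_T2" by (rule operator_eqI)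
qed

text \<open>Passing to inverses reduces the unbounded case to \<open>positive_sqrt_unique\<close>:
  the inverse \<open>Q\<close> of \<open>R\<close> is everywhere defined, bounded and positive, and
  it squares to \<open>B\<close>.\<close>

lemma sqrt_unique:
  assumes R: "selfadjoint_op R" "positive_op R" "R \<circ>\<^sub>m R = I_plus_T2"
  shows "R = R0"
proof -
  \<comment> \<open>The competing root is self-adjoint too, so the linearity and symmetry facts of
    this locale apply to it.\<close>
  interpret R: selfadjoint_operator R by standard (rule R(1))
  have RR: "x = B z \<longleftrightarrow> (\<exists>y. R x = Some y \<and> R y = Some z)" for x z
    using I_plus_T2_eq_Some[of x z] by (simp only: R(3)[symmetric] map_comp_Some_iff)
  have zero: "x = 0" if "R x = Some 0" for x
    using that RR[of x 0] R.T_zero B.zero by auto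
  have inj: "x = x'" if "R x = Some y" "R x' = Some y" for x x' y
    using zero[of "x - x'"] R.T_diff[OF that] by simp
  have surj: "\<exists>x. R x = Some y" for y using RR[of "B y" y] by blast
  define Q where "Q y = (THE x. R x = Some y)" for y
  have Q: "R (Q y) = Some y" for y
    unfolding Q_def by (rule theI') (use surj inj in blast)
  have Q_eq: "Q y = x" if "R x = Some y" for x y by (rule inj[OF Q that])
  have Q_Q: "Q (Q y) = B y" for y using RR[of "Q (Q y)" y] Q by blast
  have Q_add: "Q (x + y) = Q x + Q y" for x y by (intro Q_eq R.T_add Q)
  have Q_scale: "Q (r *\<^sub>R x) = r *\<^sub>R Q x" for r x by (intro Q_eq R.T_scaleR Q)
  have Q_sym: "inner (Q x) y = inner x (Q y)" for x y by (rule R.T_symmetric[OF Q Q])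
  have Q_norm: "norm (Q x) \<le> norm x * 1" for x
  proof -
    have "(norm (Q x))\<^sup>2 = inner x (B x)" by (simp add: power2_norm_eq_inner Q_sym Q_Q)
    also have "\<dots> \<le> norm x * norm (B x)" by (rule norm_cauchy_schwarz)
    also have "\<dots> \<le> (norm x)\<^sup>2"
      unfolding power2_eq_square by (intro mult_left_mono B_estimates) simp
    finally show ?thesis using power2_le_imp_le by fastforce
  qed
  have Q_pos: "0 \<le> inner x (Q x)" for x
  proof -
    have "cinner (Q x) x \<in> \<real>\<^sub>\<ge>\<^sub>0" using R(2) Q unfolding positive_op_def by blast
    then show ?thesis by (simp add: complex_nonneg_Reals_iff Re_cinner inner_commute)
  qed
  have "C = Q"
    by (rule positive_sqrt_unique[OF B_injective C_sqrt])
      (rule bounded_linear_intro Q_add Q_scale Q_norm Q_pos Q_Q | assumption)+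
  then have "R x = Some z \<longleftrightarrow> R0 x = Some z" for x z
    using Q[of z] Q_eq[of x z] by (auto simp: R0_eq_Some)
  then show ?thesis by (rule operator_eqI)
qed

text \<open>Uniqueness resolves the \<open>THE\<close> in \<open>op_sqrt\<close> to
  \<open>R0\<close>, whose inverse is \<open>C\<close> with full domain.\<close>

lemma bounded_transform_eq: "bounded_transform T = total_op S"
proof -
  have "op_sqrt I_plus_T2 = R0"
    unfolding op_sqrt_def by (rule the_equality) (use R0_sqrt sqrt_unique in blast)+
  moreover have "op_inverse R0 y = Some x \<longleftrightarrow> total_op C y = Some x" for x y
    by (subst op_inverse_eq_Some[of R0]) (auto simp: R0_eq_Some, auto simp: total_op_def)
  then have "op_inverse R0 = total_op C" by (rule operator_eqI)
  ultimately show ?thesis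
    by (auto simp: bounded_transform_def total_op_def map_comp_def T_C)
qed

section \<open>Commutation with T and with S\<close>

lemma commutes_with_imp_T:
  "commutes_with R T \<Longrightarrow> T x = Some u \<Longrightarrow> T (R x) = Some (R u)"
  unfolding commutes_with_def by (metis domD domI option.sel)

lemma commute_S:
  assumes R: "R \<in> bounded_ops" "commutes_with R T"
  shows "R (S x) = S (R x)"
proof -
  have lin: "bounded_linear R" using R(1) by (simp add: bounded_ops_def)
  have "R (C y) = C (R y)" for y
    by (rule C_commute[OF lin B_commute[OF lin commutes_with_imp_T[OF R(2)]]])
  then have "Some (R (S x)) = Some (S (R x))"
    using commutes_with_imp_T[OF R(2) T_C, of x] T_C[of "R x"] by simp
  then show ?thesis by simp
qed

lemma S_T_B: "T (B x) = Some (S (C x))"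
  using T_C[of "C x"] by (simp add: C_C)

text \<open>\<open>S C = T B\<close>, and applying \<open>T\<close> once more gives
  \<open>T T B = I - B\<close>.\<close>

lemma T_S_C: "T (S (C y)) = Some (y - B y)"
proof -
  obtain u v where uv: "T (B y) = Some u" "T u = Some v" "B y + v = y" by (rule B_obtain)
  then have "u = S (C y)" using S_T_B[of y] by simp
  moreover have "v = y - B y" by (metis uv(3) add_diff_cancel_left')
  ultimately show ?thesis using uv(2) by simp
qed

text \<open>It suffices to test on the dense range of \<open>C\<close>: there \<open>S (C y)\<close>
  lies in \<open>dom T\<close>, so the \<open>T\<close> in \<open>S x = T (C x)\<close> can be moved
  across.\<close>

lemma adjoint_S_S:
  assumes S': "\<And>x y. inner (S' x) y = inner x (S y)"
  shows "S' (S x) = x - B x"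
proof (rule inner_dense_eqI[OF dense_range_C])
  fix w assume "w \<in> range C"
  then obtain y where w: "w = C y" by blast
  have "inner (S' (S x)) w = inner (S x) (S (C y))" by (simp only: S' w)
  also have "\<dots> = inner (C x) (y - B y)" by (rule T_symmetric[OF T_C T_S_C, symmetric])
  also have "\<dots> = inner (x - B x) w"
    by (simp only: w inner_diff_left inner_diff_right C_symmetric B_symmetric C_C[symmetric])
  finally show "inner (S' (S x)) w = inner (x - B x) w" .
qed

text \<open>Tested against \<open>z\<close>, the right side gives \<open>inner x (B z)\<close> plus
  \<open>inner u (S (C z))\<close>, and the latter is \<open>inner x (z - B z)\<close> by symmetry
  of \<open>T\<close>. Hence \<open>S\<close> determines \<open>T\<close> on its whole
  domain.\<close>

lemma dom_subset_range_C:
  assumes S': "\<And>x y. inner (S' x) y = inner x (S y)" and u: "T x = Some u"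
  shows "x = C (C x + S' u)"
proof -
  have "inner (C (C x + S' u)) z = inner x z" for z
  proof -
    have "inner (C (C x + S' u)) z = inner x (B z) + inner u (S (C z))"
      by (simp only: C.add inner_add_left C_C C_symmetric S' B_symmetric)
    also have "inner u (S (C z)) = inner x (z - B z)"
      by (rule T_symmetric[OF u T_S_C, symmetric])
    also have "inner x (B z) + \<dots> = inner x z" by (simp add: inner_diff_right)
    finally show ?thesis .
  qed
  then show ?thesis by (metis vector_eq_rdot)
qed

text \<open>\<open>R\<close> commutes with \<open>B = I - S' S\<close>, hence with \<open>C\<close>.
  On \<open>x = C y\<close> this gives \<open>T (R x) = T (C (R y))\<close>, whose value is
  \<open>S (R y) = R (S y)\<close>.\<close>

lemma commutes_with_T:
  assumes S': "\<And>x y. inner (S' x) y = inner x (S y)" and R: "bounded_linear R"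
    and comm: "\<And>x. R (S x) = S (R x)" "\<And>x. R (S' x) = S' (R x)"
  shows "commutes_with R T"
proof -
  interpret R: bounded_linear R by (rule R)
  have B: "B x = x - S' (S x)" for x using adjoint_S_S[OF S'] by simp
  have RC: "R (C x) = C (R x)" for x
    by (rule C_commute[OF R]) (simp add: B R.diff comm)
  have "T (R x) = Some (R u)" if u: "T x = Some u" for x u
  proof -
    obtain y where y: "x = C y" using dom_subset_range_C[OF S' u] by blast
    then have "u = S y" using u T_C by simp
    then show ?thesis using T_C[of "R y"] by (simp add: y RC comm)
  qed
  then show ?thesis unfolding commutes_with_def by auto
qed

lemma affiliated_iff:
  assumes A: "von_neumann_algebra A"
  shows "affiliated T A \<longleftrightarrow> S \<in> A"
proof
  assume "affiliated T A"
  then have "R \<circ> S = S \<circ> R" if "R \<in> commutant A" for R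
    using that commute_S by (fastforce simp: affiliated_def commutant_def)
  then have "S \<in> commutant (commutant A)"
    unfolding commutant_def[of "commutant A"] using S_bounded_ops by auto
  then show "S \<in> A" using A by (simp add: von_neumann_algebra_def)
next
  assume S: "S \<in> A"
  \<comment> \<open>Closure of \<open>A\<close> under adjoints makes the commutant commute with
    \<open>S'\<close> as well as with \<open>S\<close>.\<close>
  then obtain S' where S': "S' \<in> A" "op_adjoint (total_op S) = total_op S'"
    using A by (auto simp: von_neumann_algebra_def)
  have adj: "inner (S' x) y = inner x (S y)" for x y
    using op_adjoint_eq_Some[OF densely_defined_total_op[OF S_bounded_ops], of x "S' x"] S'(2)
    by (simp add: total_op_def)
  have "commutes_with R T" if R: "R \<in> commutant A" for R
  proof (rule commutes_with_T[OF adj])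
    show "bounded_linear R" using R by (simp add: commutant_def bounded_ops_def)
    show "R (S x) = S (R x)" "R (S' x) = S' (R x)" for x
      using R S S'(1) by (auto simp: commutant_def fun_eq_iff)
  qed
  then show "affiliated T A"
    using linear closed_graph by (simp add: affiliated_def closed_op_def)
qed

end

theorem theorem3:
  fixes T :: "'a::complex_hilbert_space operator"
    and A :: "('a \<Rightarrow> 'a) set"
  assumes "selfadjoint_op T"
    and "von_neumann_algebra A"
  shows "affiliated T A \<longleftrightarrow> bounded_transform T \<in> total_op ` A"
proof -
  interpret selfadjoint_operator T by standard (rule assms(1))
  \<comment> \<open>Injectivity turns membership of \<open>total_op S\<close> in the image of
    \<open>A\<close> into \<open>S \<in> A\<close>.\<close>
  have "inj (total_op :: ('a \<Rightarrow> 'a) \<Rightarrow> _)" by (auto simp: inj_def total_op_def fun_eq_iff)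
  then show ?thesis
    by (simp add: affiliated_iff[OF assms(2)] bounded_transform_eq inj_image_mem_iff)
qed

end
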